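(* Let $\mu$ be a positive integer and, for $i=1,2$, let $G_i$ be a $\mu$-simultaneous edge colorable graph of order $n_i\ge 2$. Then the join $G_1\vee G_2$ has a $\mu$-simultaneous edge coloring.
   Context: All graphs are finite and simple; $[l]=\{1,\ldots,l\}$. A $\mu$-simultaneous edge coloring of a graph $G$ is a $\mu$-tuple $(c_1,\ldots,c_\mu)$ of proper edge colorings $c_i:E(G)\to[l]$ (with a common color set $[l]$) such that (1) for every vertex $v$, the set $\{c_i(e): e \text{ incident to } v\}$ is the same for all $i$, and (2) $c_i(e)\neq c_j(e)$ for every edge $e$ and all $i\neq j$. $G$ is $\mu$-simultaneous edge colorable if it has such a coloring for some $l$. The join $G_1\vee G_2$ is obtained from the disjoint union of $G_1$ and $G_2$ by adding all edges $uv$ with $u\in V(G_1)$, $v\in V(G_2)$.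
   Formalization: Each graph G_i is additionally assumed to have an edge or at least μ vertices; without this the claim fails, e.g. for μ=3 and two edgeless graphs of order 2, whose join is the 4-cycle. *)

theory Defs
  imports Main
begin

record 'a ugraph =
  verts :: "'a set"
  edges :: "'a set set"

definition simple_graph :: "'a ugraph \<Rightarrow> bool" where
  "simple_graph G \<longleftrightarrow> finite (verts G) \<and> (\<forall>e\<in>edges G. e \<subseteq> verts G \<and> card e = 2)"

definition proper_edge_coloring :: "'a ugraph \<Rightarrow> nat \<Rightarrow> ('a set \<Rightarrow> nat) \<Rightarrow> bool" where
  "proper_edge_coloring G l c \<longleftrightarrow>
     (\<forall>e\<in>edges G. c e \<in> {1..l}) \<and>
     (\<forall>e\<in>edges G. \<forall>f\<in>edges G. e \<noteq> f \<and> e \<inter> f \<noteq> {} \<longrightarrow> c e \<noteq> c f)"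

definition colors_at :: "'a ugraph \<Rightarrow> ('a set \<Rightarrow> nat) \<Rightarrow> 'a \<Rightarrow> nat set" where
  "colors_at G c v = {c e | e. e \<in> edges G \<and> v \<in> e}"

(* The mu-tuple (c_1, ..., c_mu) is encoded as a function; only its values at 1, ..., mu matter,
   and each c_i matters only on the edges of G. *)
definition simultaneous_edge_coloring ::
    "nat \<Rightarrow> 'a ugraph \<Rightarrow> nat \<Rightarrow> (nat \<Rightarrow> 'a set \<Rightarrow> nat) \<Rightarrow> bool" where
  "simultaneous_edge_coloring \<mu> G l c \<longleftrightarrow>
     (\<forall>i\<in>{1..\<mu>}. proper_edge_coloring G l (c i)) \<and>
     (\<forall>v\<in>verts G. \<forall>i\<in>{1..\<mu>}. \<forall>j\<in>{1..\<mu>}. colors_at G (c i) v = colors_at G (c j) v) \<and>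
     (\<forall>e\<in>edges G. \<forall>i\<in>{1..\<mu>}. \<forall>j\<in>{1..\<mu>}. i \<noteq> j \<longrightarrow> c i e \<noteq> c j e)"

(* Pitfall: an edgeless graph is vacuously colorable for every mu, whereas in any colorable graph
   a vertex of positive degree has degree at least mu (the colors c_1 e, ..., c_mu e of an incident
   edge e are distinct members of the common color set at the vertex).  Hence a colorable graph with
   an edge has more than mu vertices, but an edgeless one may have fewer than mu, and for instance
   the join of two edgeless graphs of order 2, a 4-cycle, is not colorable for mu = 3. *)
definition simultaneous_edge_colorable :: "nat \<Rightarrow> 'a ugraph \<Rightarrow> bool" where
  "simultaneous_edge_colorable \<mu> G \<longleftrightarrow> (\<exists>l c. simultaneous_edge_coloring \<mu> G l c)"

definition graph_join :: "'a ugraph \<Rightarrow> 'b ugraph \<Rightarrow> ('a + 'b) ugraph" (infixl "\<or>\<^sub>G" 65) where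
  "G1 \<or>\<^sub>G G2 =
     \<lparr>verts = verts G1 <+> verts G2,
      edges = (\<lambda>e. Inl ` e) ` edges G1 \<union> (\<lambda>e. Inr ` e) ` edges G2 \<union>
              {{Inl u, Inr v} | u v. u \<in> verts G1 \<and> v \<in> verts G2}\<rparr>"

lemma simple_graph_join:
  assumes "simple_graph G1" and "simple_graph G2"
  shows "simple_graph (G1 \<or>\<^sub>G G2)"
  using assms unfolding simple_graph_def graph_join_def
  by (auto simp: card_image inj_on_def)

end

theory Submission
  imports Defs
begin

text \<open>A colorable graph with an edge has more than \<open>\<mu>\<close> vertices, so both orders are at least
  \<open>\<mu>\<close>.  Give \<open>G\<^sub>1\<close>, \<open>G\<^sub>2\<close> and the complete bipartite graph between them disjoint palettes; it
  remains to color that bipartite graph.  If its sides \<open>{0..<m}\<close> and \<open>{0..<n}\<close> satisfy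
  \<open>\<mu> \<le> m \<le> n\<close>, let the \<open>i\<close>-th coloring give \<open>uv\<close> the color \<open>((u + i) mod m + v) mod n\<close>: every
  vertex of the first side sees all residues modulo \<open>n\<close>, the vertex \<open>v\<close> of the second side
  sees \<open>v, \<dots>, v + m - 1\<close>, and the summand \<open>(u + i) mod m\<close> separates the colorings.\<close>

lemma simple_graph_edge_nonempty: "simple_graph G \<Longrightarrow> e \<in> edges G \<Longrightarrow> e \<noteq> {}"
  by (fastforce simp: simple_graph_def)

text \<open>Fix an edge \<open>e\<close> through \<open>v\<close>. The \<mu> colorings give
  \<open>e\<close> distinct colors, all of them in the common color set at \<open>v\<close>. The
  first coloring alone realises this set, so at least \<mu> edges meet \<open>v\<close>, and each is
  determined by its other end.\<close>

lemma card_verts_ge_if_edge: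
  assumes G: "simple_graph G" and c: "simultaneous_edge_colorable \<mu> G" and "edges G \<noteq> {}"
  shows "\<mu> \<le> card (verts G)"
proof -
  obtain l c where c: "simultaneous_edge_coloring \<mu> G l c"
    using c by (auto simp: simultaneous_edge_colorable_def)
  obtain e where e: "e \<in> edges G" using assms(3) by blast
  then obtain v where v: "v \<in> e" "v \<in> verts G"
    using G simple_graph_edge_nonempty[of G e] unfolding simple_graph_def by blast
  have fin: "finite (verts G)" using G by (simp add: simple_graph_def)
  let ?I = "{f \<in> edges G. v \<in> f}"
  \<comment> \<open>Letting \<open>w\<close> range over all vertices, \<open>v\<close> included,
    gives up one in the count; the weak bound on the order is all that the join requires.\<close>
  have I: "?I \<subseteq> (\<lambda>w. {v, w}) ` verts G"
  proof
    fix f assume f: "f \<in> ?I"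
    then obtain a b where "f = {a, b}" "f \<subseteq> verts G"
      using G by (auto simp: simple_graph_def card_2_iff)
    with f show "f \<in> (\<lambda>w. {v, w}) ` verts G" by auto
  qed
  have fI: "finite ?I" using finite_subset[OF I] fin by simp
  have sub: "(\<lambda>i. c i e) ` {1..\<mu>} \<subseteq> c 1 ` ?I"
  proof
    fix x assume "x \<in> (\<lambda>i. c i e) ` {1..\<mu>}"
    then obtain i where i: "i \<in> {1..\<mu>}" "x = c i e" by blast
    then have "x \<in> colors_at G (c i) v" using e v by (auto simp: colors_at_def)
    moreover have "1 \<in> {1..\<mu>}" using i by auto
    then have "colors_at G (c i) v = colors_at G (c 1) v"
      using c i v(2) unfolding simultaneous_edge_coloring_def by blast
    ultimately show "x \<in> c 1 ` ?I" by (auto simp: colors_at_def)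
  qed
  have "inj_on (\<lambda>i. c i e) {1..\<mu>}"
    using c e unfolding simultaneous_edge_coloring_def inj_on_def by blast
  then have "\<mu> = card ((\<lambda>i. c i e) ` {1..\<mu>})" by (simp add: card_image)
  also have "\<dots> \<le> card (c 1 ` ?I)" using sub fI by (intro card_mono) auto
  also have "\<dots> \<le> card ?I" using fI by (rule card_image_le)
  also have "\<dots> \<le> card ((\<lambda>w. {v, w}) ` verts G)" using I fin by (intro card_mono) auto
  also have "\<dots> \<le> card (verts G)" using fin by (rule card_image_le)
  finally show ?thesis .
qed

text \<open>\<open>b i u v\<close> is the color of the cross edge \<open>uv\<close> in the
  \<open>i\<close>-th coloring, counted from 0. Only the last clause restricts the indices: a
  coloring built from cyclic shifts is periodic in \<open>i\<close>, so distinctness can hold only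
  on a bounded window.\<close>

definition bipartite_coloring ::
    "nat \<Rightarrow> 'a set \<Rightarrow> 'b set \<Rightarrow> nat \<Rightarrow> (nat \<Rightarrow> 'a \<Rightarrow> 'b \<Rightarrow> nat) \<Rightarrow> bool" where
  "bipartite_coloring \<mu> A B l b \<longleftrightarrow>
     (\<forall>i. \<forall>u\<in>A. \<forall>v\<in>B. b i u v < l) \<and>
     (\<forall>i. \<forall>u\<in>A. inj_on (b i u) B) \<and>
     (\<forall>i. \<forall>v\<in>B. inj_on (\<lambda>u. b i u v) A) \<and>
     (\<forall>i j. \<forall>u\<in>A. b i u ` B = b j u ` B) \<and>
     (\<forall>i j. \<forall>v\<in>B. (\<lambda>u. b i u v) ` A = (\<lambda>u. b j u v) ` A) \<and>
     (\<forall>i\<in>{1..\<mu>}. \<forall>j\<in>{1..\<mu>}. \<forall>u\<in>A. \<forall>v\<in>B. i \<noteq> j \<longrightarrow> b i u v \<noteq> b j u v)"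

text \<open>This lets the smaller side play the part of \<open>A\<close> in the construction, which
  treats its two sides differently.\<close>

lemma bipartite_coloring_swap:
  "bipartite_coloring \<mu> A B l b \<Longrightarrow> bipartite_coloring \<mu> B A l (\<lambda>i v u. b i u v)"
  unfolding bipartite_coloring_def by blast

lemma bij_betw_add_mod:
  fixes k n :: nat
  shows "bij_betw (\<lambda>x. (x + k) mod n) {0..<n} {0..<n}"
proof (cases "n = 0")
  case False
  have "inj_on (\<lambda>x. (x + k) mod n) {0..<n}"
  proof (rule inj_onI)
    fix x y assume "x \<in> {0..<n}" "y \<in> {0..<n}" "(x + k) mod n = (y + k) mod n"
    then show "x = y"
    \<comment> \<open>By symmetry \<open>x \<le> y\<close>, so the natural number
      \<open>y - x\<close> is a true difference; it is a multiple of \<open>n\<close> below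
      \<open>n\<close>, hence 0.\<close>
    proof (induction x y rule: linorder_wlog)
      case (le x y)
      then have "n dvd y - x" using mod_eq_dvd_iff_nat[of "x + k" "y + k" n] by simp
      then show ?case using le dvd_imp_le[of n "y - x"] by fastforce
    qed simp
  qed
  moreover have "(\<lambda>x. (x + k) mod n) ` {0..<n} \<subseteq> {0..<n}" using False by auto
  ultimately show ?thesis
    by (simp add: bij_betw_def endo_inj_surj)
qed (simp add: bij_betw_def)

text \<open>The bound \<open>\<mu> \<le> card A\<close> makes the shifts by 1, ..., \<mu> pairwise
  different modulo \<open>card A\<close>. The bound \<open>card A \<le> card B\<close> keeps
  different values of \<open>s\<close> different when they are reduced modulo
  \<open>card B\<close>.\<close>

lemma bipartite_coloring_if_card_le:
  assumes "finite A" "finite B" "\<mu> \<le> card A" "card A \<le> card B"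
  shows "\<exists>l b. bipartite_coloring \<mu> A B l b"
proof -
  obtain f where f: "bij_betw f A {0..<card A}"
    using ex_bij_betw_finite_nat assms(1) by blast
  obtain g where g: "bij_betw g B {0..<card B}"
    using ex_bij_betw_finite_nat assms(2) by blast
  define s where "s = (\<lambda>i u. (f u + i) mod card A)"
  define b where "b = (\<lambda>i u v. (s i u + g v) mod card B)"
  have row: "bij_betw (b i u) B {0..<card B}" for i u
    using bij_betw_trans[OF g bij_betw_add_mod[of "s i u"]]
    by (simp add: b_def o_def add.commute)
  have s: "bij_betw (s i) A {0..<card A}" for i
    using bij_betw_trans[OF f bij_betw_add_mod[of i]] by (simp add: s_def o_def)
  have sinj: "i = j" if "s i u = s j u" "i \<in> {1..\<mu>}" "j \<in> {1..\<mu>}" for i j u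
  proof -
    \<comment> \<open>Indices start at 1, so \<open>i\<close> is written as \<open>i - 1\<close>
      plus 1. The window then lies in \<open>{0..<card A}\<close>, where the rotation is injective,
      even if \<open>\<mu> = card A\<close>.\<close>
    have "inj_on (\<lambda>i. (i + (f u + 1)) mod card A) {0..<card A}"
      using bij_betw_add_mod bij_betw_def by blast
    moreover have "i - 1 \<in> {0..<card A}" "j - 1 \<in> {0..<card A}"
      using that assms by auto
    moreover have "(i - 1 + (f u + 1)) mod card A = (j - 1 + (f u + 1)) mod card A"
      using that by (simp add: s_def add.commute)
    ultimately have "i - 1 = j - 1" by (simp only: inj_on_def)
    then show ?thesis using that by auto
  qed
  have col: "inj_on (\<lambda>x. (x + g v) mod card B) {0..<card A}" for v
    using bij_betw_add_mod[of "g v" "card B"] assms(4)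
    by (auto simp: bij_betw_def intro: inj_on_subset)
  have "bipartite_coloring \<mu> A B (card B) b"
    unfolding bipartite_coloring_def
  proof (intro conjI allI ballI impI)
    fix i j u v assume uv: "u \<in> A" "v \<in> B"
    show "b i u v < card B" using row[of i u] uv by (auto simp: bij_betw_def)
    assume ij: "i \<in> {1..\<mu>}" "j \<in> {1..\<mu>}" "i \<noteq> j"
    have "s i u \<noteq> s j u" using sinj ij by blast
    moreover have "s i u \<in> {0..<card A}" "s j u \<in> {0..<card A}"
      using s uv bij_betwE by blast+
    ultimately show "b i u v \<noteq> b j u v"
      unfolding b_def using inj_onD[OF col[of v], of "s i u" "s j u"] by blast
  next
    fix i j v
    show "inj_on (\<lambda>u. b i u v) A"
      using comp_inj_on[of "s i" A "\<lambda>x. (x + g v) mod card B"] s[of i] col[of v]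
      by (simp add: b_def o_def bij_betw_def)
    \<comment> \<open>Each \<open>s k\<close> runs through all of \<open>{0..<card A}\<close>, so
      \<open>k\<close> has disappeared from the right-hand side.\<close>
    have "(\<lambda>u. b k u v) ` A = (\<lambda>x. (x + g v) mod card B) ` {0..<card A}" for k
      using image_image[of "\<lambda>x. (x + g v) mod card B" "s k" A] s[of k]
      by (simp add: b_def bij_betw_def)
    then show "(\<lambda>u. b i u v) ` A = (\<lambda>u. b j u v) ` A" by simp
  next
    fix i j u
    show "inj_on (b i u) B" "b i u ` B = b j u ` B"
      using row by (auto simp: bij_betw_def)
  qed
  then show ?thesis by blast
qed

lemma bipartite_coloring_exists:
  assumes "finite A" "finite B" "\<mu> \<le> card A" "\<mu> \<le> card B"
  shows "\<exists>l b. bipartite_coloring \<mu> A B l b"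
proof (cases "card A \<le> card B")
  case True
  then show ?thesis using assms bipartite_coloring_if_card_le by blast
next
  case False
  then show ?thesis
    using assms bipartite_coloring_if_card_le[of B A \<mu>] bipartite_coloring_swap by fastforce
qed

text \<open>The palettes are 1 to \<open>l1\<close>, then \<open>l1 + 1\<close> to
  \<open>l1 + l2\<close>, and everything from \<open>l1 + l2 + 1\<close> on for cross edges; the
  extra 1 is there because \<open>b\<close> counts from 0. The type of an edge is read off from the
  summands containing its ends.\<close>

definition join_coloring ::
    "nat \<Rightarrow> nat \<Rightarrow> ('a set \<Rightarrow> nat) \<Rightarrow> ('b set \<Rightarrow> nat) \<Rightarrow> ('a \<Rightarrow> 'b \<Rightarrow> nat) \<Rightarrow> ('a + 'b) set \<Rightarrow> nat" where
  "join_coloring l1 l2 c1 c2 b e =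
     (if e \<subseteq> range Inl then c1 (Inl -` e)
      else if e \<subseteq> range Inr then l1 + c2 (Inr -` e)
      else l1 + l2 + 1 + b (THE u. Inl u \<in> e) (THE v. Inr v \<in> e))"

lemma join_coloring_Inl [simp]: "join_coloring l1 l2 c1 c2 b (Inl ` e) = c1 e"
  by (auto simp: join_coloring_def inj_vimage_image_eq)

text \<open>The empty set is contained in \<open>range Inl\<close> and would fall under the first
  branch. Simplicity of \<open>G2\<close> rules it out as an edge in the lemmas below.\<close>

lemma join_coloring_Inr [simp]:
  "e \<noteq> {} \<Longrightarrow> join_coloring l1 l2 c1 c2 b (Inr ` e) = l1 + c2 e"
  by (auto simp: join_coloring_def inj_vimage_image_eq)

lemma join_coloring_cross [simp]:
  "join_coloring l1 l2 c1 c2 b {Inl u, Inr v} = l1 + l2 + 1 + b u v"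
  by (auto simp: join_coloring_def)

lemma edges_join_cases:
  assumes "e \<in> edges (G1 \<or>\<^sub>G G2)"
  obtains (left) e' where "e' \<in> edges G1" "e = Inl ` e'"
    | (right) e' where "e' \<in> edges G2" "e = Inr ` e'"
    | (cross) u v where "u \<in> verts G1" "v \<in> verts G2" "e = {Inl u, Inr v}"
  using assms by (auto simp: graph_join_def)

text \<open>Edges of \<open>G1\<close> and \<open>G2\<close> never meet in the join, and a cross
  edge has a color above \<open>l1 + l2\<close>, larger than that of any other type. Only two edges
  of the same type remain to be compared.\<close>

lemma proper_join_coloring:
  assumes G2: "simple_graph G2"
    and c1: "proper_edge_coloring G1 l1 c1" and c2: "proper_edge_coloring G2 l2 c2"
    and b: "\<And>u v. u \<in> verts G1 \<Longrightarrow> v \<in> verts G2 \<Longrightarrow> b u v < l"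
    and bu: "\<And>u. u \<in> verts G1 \<Longrightarrow> inj_on (b u) (verts G2)"
    and bv: "\<And>v. v \<in> verts G2 \<Longrightarrow> inj_on (\<lambda>u. b u v) (verts G1)"
  shows "proper_edge_coloring (G1 \<or>\<^sub>G G2) (l1 + l2 + 1 + l) (join_coloring l1 l2 c1 c2 b)"
    (is "proper_edge_coloring ?G ?l ?c")
proof -
  note [simp] = simple_graph_edge_nonempty[OF G2]
  have r1: "1 \<le> c1 e \<and> c1 e \<le> l1" if "e \<in> edges G1" for e
    using c1 that by (auto simp: proper_edge_coloring_def)
  have r2: "1 \<le> c2 e \<and> c2 e \<le> l2" if "e \<in> edges G2" for e
    using c2 that by (auto simp: proper_edge_coloring_def)
  have "?c e \<in> {1..?l}" if "e \<in> edges ?G" for e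
    using that
  proof (cases rule: edges_join_cases)
    case (left e') then show ?thesis using r1[of e'] by auto
  next
    case (right e') then show ?thesis using r2[of e'] by auto
  next
    case (cross u v) then show ?thesis using b[of u v] by auto
  qed
  moreover have "e = f" if e: "e \<in> edges ?G" and f: "f \<in> edges ?G"
    and meet: "e \<inter> f \<noteq> {}" and eq: "?c e = ?c f" for e f
    using e
  proof (cases rule: edges_join_cases)
    case e: (left e')
    from f show ?thesis
    proof (cases rule: edges_join_cases)
      case (left f')
      with e meet eq have "c1 e' = c1 f'" "e' \<inter> f' \<noteq> {}" by auto
      with e left c1 show ?thesis unfolding proper_edge_coloring_def by blast
    next
      case (right f')
      with e meet show ?thesis by auto
    next
      case (cross u v)
      with e eq r1[of e'] show ?thesis by auto
    qed
  next
    case e: (right e')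
    from f show ?thesis
    proof (cases rule: edges_join_cases)
      case (left f')
      with e meet show ?thesis by auto
    next
      case (right f')
      with e meet eq have "c2 e' = c2 f'" "e' \<inter> f' \<noteq> {}" by auto
      with e right c2 show ?thesis unfolding proper_edge_coloring_def by blast
    next
      case (cross u v)
      with e eq r2[of e'] show ?thesis by auto
    qed
  next
    case e: (cross u v)
    from f show ?thesis
    proof (cases rule: edges_join_cases)
      case (left f')
      with e eq r1[of f'] show ?thesis by auto
    next
      case (right f')
      with e eq r2[of f'] show ?thesis by auto
    next
      case (cross u' v')
      \<comment> \<open>Cross edges that meet share an end; injectivity of \<open>b\<close> in the
        other argument then identifies the remaining ends.\<close>
      with e meet eq have "b u v = b u' v'" "u = u' \<or> v = v'" by auto
      with e cross show ?thesis using inj_onD[OF bu[of u]] inj_onD[OF bv[of v]] by auto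
    qed
  qed
  ultimately show ?thesis unfolding proper_edge_coloring_def by blast
qed

text \<open>With the color set split into an inner and a cross part, independence of the coloring
  index can be checked for \<open>G1\<close> and for \<open>b\<close> separately.\<close>

lemma colors_at_join_Inl:
  assumes "u \<in> verts G1"
  shows "colors_at (G1 \<or>\<^sub>G G2) (join_coloring l1 l2 c1 c2 b) (Inl u) =
    colors_at G1 c1 u \<union> (\<lambda>k. l1 + l2 + 1 + k) ` b u ` verts G2" (is "?L = ?R")
proof
  show "?L \<subseteq> ?R"
  proof
    fix x assume "x \<in> ?L"
    then obtain e where e: "e \<in> edges (G1 \<or>\<^sub>G G2)" "Inl u \<in> e"
      and x: "x = join_coloring l1 l2 c1 c2 b e"
      by (auto simp: colors_at_def)
    from e(1) show "x \<in> ?R"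
      by (cases rule: edges_join_cases) (use e(2) x in \<open>auto simp: colors_at_def\<close>)
  qed
  have "c1 e \<in> ?L" if "e \<in> edges G1" "u \<in> e" for e
    unfolding colors_at_def using that
    by (intro CollectI exI[of _ "Inl ` e"]) (auto simp: graph_join_def)
  moreover have "l1 + l2 + 1 + b u v \<in> ?L" if "v \<in> verts G2" for v
    unfolding colors_at_def using that assms
    by (intro CollectI exI[of _ "{Inl u, Inr v}"]) (auto simp: graph_join_def)
  ultimately show "?R \<subseteq> ?L" by (auto simp: colors_at_def[of G1])
qed

lemma colors_at_join_Inr:
  assumes G2: "simple_graph G2" and "v \<in> verts G2"
  shows "colors_at (G1 \<or>\<^sub>G G2) (join_coloring l1 l2 c1 c2 b) (Inr v) =
    (\<lambda>k. l1 + k) ` colors_at G2 c2 v \<union> (\<lambda>k. l1 + l2 + 1 + k) ` (\<lambda>u. b u v) ` verts G1"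
    (is "?L = ?R")
proof
  note [simp] = simple_graph_edge_nonempty[OF G2]
  show "?L \<subseteq> ?R"
  proof
    fix x assume "x \<in> ?L"
    then obtain e where e: "e \<in> edges (G1 \<or>\<^sub>G G2)" "Inr v \<in> e"
      and x: "x = join_coloring l1 l2 c1 c2 b e"
      by (auto simp: colors_at_def)
    from e(1) show "x \<in> ?R"
      by (cases rule: edges_join_cases) (use e(2) x in \<open>auto simp: colors_at_def\<close>)
  qed
  have "l1 + c2 e \<in> ?L" if "e \<in> edges G2" "v \<in> e" for e
    unfolding colors_at_def using that
    by (intro CollectI exI[of _ "Inr ` e"]) (auto simp: graph_join_def)
  moreover have "l1 + l2 + 1 + b u v \<in> ?L" if "u \<in> verts G1" for u
    unfolding colors_at_def using that assms
    by (intro CollectI exI[of _ "{Inl u, Inr v}"]) (auto simp: graph_join_def)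
  ultimately show "?R \<subseteq> ?L" by (auto simp: colors_at_def[of G2])
qed

theorem theorem2p9:
  fixes \<mu> :: nat and G1 :: "'a ugraph" and G2 :: "'b ugraph"
  assumes "\<mu> \<ge> 1"
    and "simple_graph G1" and "simple_graph G2"
    and "card (verts G1) \<ge> 2" and "card (verts G2) \<ge> 2"
    and "edges G1 \<noteq> {} \<or> card (verts G1) \<ge> \<mu>"
    and "edges G2 \<noteq> {} \<or> card (verts G2) \<ge> \<mu>"
    and "simultaneous_edge_colorable \<mu> G1" and "simultaneous_edge_colorable \<mu> G2"
  shows "simultaneous_edge_colorable \<mu> (G1 \<or>\<^sub>G G2)"
proof -
  note G2 = \<open>simple_graph G2\<close>
  note [simp] = simple_graph_edge_nonempty[OF G2]
  obtain l1 c1 l2 c2 where c1: "simultaneous_edge_coloring \<mu> G1 l1 c1"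
    and c2: "simultaneous_edge_coloring \<mu> G2 l2 c2"
    using assms by (auto simp: simultaneous_edge_colorable_def)
  \<comment> \<open>For each graph the disjunctive hypothesis either states this bound or supplies
    an edge, from which colorability yields it.\<close>
  have "\<mu> \<le> card (verts G1)" "\<mu> \<le> card (verts G2)"
    using card_verts_ge_if_edge[of G1 \<mu>] card_verts_ge_if_edge[of G2 \<mu>] assms by argo+
  then obtain l b where b: "bipartite_coloring \<mu> (verts G1) (verts G2) l b"
    using bipartite_coloring_exists[of "verts G1" "verts G2" \<mu>] assms(2,3)
    by (auto simp: simple_graph_def)
  define c where "c = (\<lambda>i. join_coloring l1 l2 (c1 i) (c2 i) (b i))"
  have "simultaneous_edge_coloring \<mu> (G1 \<or>\<^sub>G G2) (l1 + l2 + 1 + l) c"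
    unfolding simultaneous_edge_coloring_def
  proof (intro conjI ballI impI)
    fix i assume i: "i \<in> {1..\<mu>}"
    show "proper_edge_coloring (G1 \<or>\<^sub>G G2) (l1 + l2 + 1 + l) (c i)"
      unfolding c_def using c1 c2 b i G2
      by (intro proper_join_coloring)
        (simp_all add: simultaneous_edge_coloring_def bipartite_coloring_def)
    fix j assume j: "j \<in> {1..\<mu>}"
    {
      fix w assume "w \<in> verts (G1 \<or>\<^sub>G G2)"
      then consider u where "u \<in> verts G1" "w = Inl u" | v where "v \<in> verts G2" "w = Inr v"
        by (auto simp: graph_join_def)
      then show "colors_at (G1 \<or>\<^sub>G G2) (c i) w = colors_at (G1 \<or>\<^sub>G G2) (c j) w"
      proof cases
        case 1
        then have "colors_at G1 (c1 i) u = colors_at G1 (c1 j) u"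
          using c1 i j unfolding simultaneous_edge_coloring_def by blast
        moreover have "b i u ` verts G2 = b j u ` verts G2"
          using b 1(1) unfolding bipartite_coloring_def by metis
        ultimately show ?thesis by (simp add: 1 c_def colors_at_join_Inl)
      next
        case 2
        then have "colors_at G2 (c2 i) v = colors_at G2 (c2 j) v"
          using c2 i j unfolding simultaneous_edge_coloring_def by blast
        moreover have "(\<lambda>u. b i u v) ` verts G1 = (\<lambda>u. b j u v) ` verts G1"
          using b 2(1) unfolding bipartite_coloring_def by metis
        ultimately show ?thesis by (simp add: 2 c_def colors_at_join_Inr[OF G2])
      qed
    next
      fix e assume e: "e \<in> edges (G1 \<or>\<^sub>G G2)" and ij: "i \<noteq> j"
      \<comment> \<open>The type of \<open>e\<close>, and with it the offset added to its color, is
        the same for \<open>i\<close> and \<open>j\<close>, so distinctness is inherited from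
        \<open>c1\<close>, \<open>c2\<close> or \<open>b\<close>.\<close>
      from e show "c i e \<noteq> c j e"
      proof (cases rule: edges_join_cases)
        case (left e')
        then show ?thesis using c1 i j ij by (simp add: c_def simultaneous_edge_coloring_def)
      next
        case (right e')
        then show ?thesis using c2 i j ij by (simp add: c_def simultaneous_edge_coloring_def)
      next
        case (cross u v)
        then show ?thesis using b i j ij by (simp add: c_def bipartite_coloring_def)
      qed
    }
  qed
  then show ?thesis by (auto simp: simultaneous_edge_colorable_def)
qed

end
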